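(* Let $\mu_1,\mu_2$ be sub-distributions over countable sets $A_1,A_2$, let $R\subseteq A_1\times A_2$, and let $\varepsilon,\delta$ be reals such that $\mu_1(S_1)\le e^{\varepsilon}\mu_2(R(S_1))+\delta$ for every $S_1\subseteq A_1$, where $R(S_1)=\{a_2\in A_2:\exists a_1\in S_1,\,(a_1,a_2)\in R\}$. Then there is an $(\varepsilon,\delta)$-approximate lifting of $R$ relating $\mu_1$ and $\mu_2$.
   Context: A sub-distribution over a countable set $A$ is $\mu:A\to[0,1]$ with $\sum_a\mu(a)\le1$; $\mu(X)=\sum_{a\in X}\mu(a)$; marginals of $\mu$ over $A_1\times A_2$ are $\pi_1(\mu)(a_1)=\sum_{a_2}\mu(a_1,a_2)$, $\pi_2(\mu)(a_2)=\sum_{a_1}\mu(a_1,a_2)$. $d_\varepsilon(\nu_1,\nu_2)=\max_{X}(\nu_1(X)-e^{\varepsilon}\nu_2(X))$. With a fresh element $\star$, $A^\star=A\cup\{\star\}$ and $R^\star=R\cup(A_1\times\{\star\})\cup(\{\star\}\times A_2)$. An $(\varepsilon,\delta)$-approximate $R$-lifting of $(\mu_1,\mu_2)$ exists if there are sub-distributions $\mu_L,\mu_R$ over $A_1^\star\times A_2^\star$ with $\pi_1(\mu_L)=\mu_1$, $\pi_2(\mu_R)=\mu_2$ (with $\mu_i(\star)=0$), $\mathrm{supp}(\mu_L)\cup\mathrm{supp}(\mu_R)\subseteq R^\star$, and $d_\varepsilon(\mu_L,\mu_R)\le\delta$. *)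

theory Defs
  imports "HOL-Probability.Probability"
begin

text \<open>
  A sub-distribution over a countable set \<open>A\<close> is a \<open>\<mu> :: 'a spmf\<close> with \<open>set_spmf \<mu> \<subseteq> A\<close>:
  \<open>spmf \<mu> a\<close> is \<open>\<mu>(a)\<close> and \<open>measure (measure_spmf \<mu>) X\<close> is \<open>\<mu>(X)\<close>.
\<close>

lemma measure_spmf_has_sum:
  "(spmf \<mu> has_sum measure (measure_spmf \<mu>) X) X"
proof -
  have s: "Infinite_Set_Sum.abs_summable_on (pmf \<mu>) (Some ` X)"
    by (rule pmf_abs_summable)
  have "pmf \<mu> summable_on Some ` X"
    using s abs_summable_equivalent abs_summable_summable by blast
  moreover have "measure (measure_spmf \<mu>) X = infsum (pmf \<mu>) (Some ` X)"
    by (simp add: measure_measure_spmf_conv_measure_pmf measure_pmf_conv_infsetsum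
        infsetsum_infsum[OF s])
  ultimately have "(pmf \<mu> has_sum measure (measure_spmf \<mu>) X) (Some ` X)"
    by (simp add: has_sum_infsum)
  then show ?thesis
    by (subst (asm) has_sum_reindex) (auto simp: o_def)
qed

lemma spmf_map_fst_has_sum:
  assumes "set_spmf \<mu> \<subseteq> A1 \<times> A2"
  shows "((\<lambda>a2. spmf \<mu> (a1, a2)) has_sum spmf (map_spmf fst \<mu>) a1) A2"
proof -
  have "(spmf \<mu> has_sum spmf (map_spmf fst \<mu>) a1) (fst -` {a1})"
    unfolding spmf_map by (rule measure_spmf_has_sum)
  also have "?this \<longleftrightarrow> (spmf \<mu> has_sum spmf (map_spmf fst \<mu>) a1) (Pair a1 ` A2)"
    using assms by (intro has_sum_cong_neutral) (auto simp: spmf_eq_0_set_spmf)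
  also have "\<dots> \<longleftrightarrow> ?thesis"
    by (subst has_sum_reindex) (auto simp: o_def inj_on_def)
  finally show ?thesis .
qed

lemma spmf_map_snd_has_sum:
  assumes "set_spmf \<mu> \<subseteq> A1 \<times> A2"
  shows "((\<lambda>a1. spmf \<mu> (a1, a2)) has_sum spmf (map_spmf snd \<mu>) a2) A1"
proof -
  have "(spmf \<mu> has_sum spmf (map_spmf snd \<mu>) a2) (snd -` {a2})"
    unfolding spmf_map by (rule measure_spmf_has_sum)
  also have "?this \<longleftrightarrow> (spmf \<mu> has_sum spmf (map_spmf snd \<mu>) a2) ((\<lambda>a1. (a1, a2)) ` A1)"
    using assms by (intro has_sum_cong_neutral) (auto simp: spmf_eq_0_set_spmf)
  also have "\<dots> \<longleftrightarrow> ?thesis"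
    by (subst has_sum_reindex) (auto simp: o_def inj_on_def)
  finally show ?thesis .
qed

text \<open>The supremum below is a maximum, see \<open>eps_dist_attained\<close>.\<close>

definition eps_dist :: "'a set \<Rightarrow> real \<Rightarrow> 'a spmf \<Rightarrow> 'a spmf \<Rightarrow> real" where
  "eps_dist A \<epsilon> \<nu>1 \<nu>2 =
     (SUP X\<in>Pow A. measure (measure_spmf \<nu>1) X - exp \<epsilon> * measure (measure_spmf \<nu>2) X)"

lemma eps_dist_attained:
  "\<exists>X0\<subseteq>A. eps_dist A \<epsilon> \<nu>1 \<nu>2 =
       measure (measure_spmf \<nu>1) X0 - exp \<epsilon> * measure (measure_spmf \<nu>2) X0
     \<and> (\<forall>X\<subseteq>A. measure (measure_spmf \<nu>1) X - exp \<epsilon> * measure (measure_spmf \<nu>2) X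
            \<le> eps_dist A \<epsilon> \<nu>1 \<nu>2)"
proof -
  define f where "f = (\<lambda>a. spmf \<nu>1 a - exp \<epsilon> * spmf \<nu>2 a)"
  define d where
    "d = (\<lambda>X. measure (measure_spmf \<nu>1) X - exp \<epsilon> * measure (measure_spmf \<nu>2) X)"
  define X0 where "X0 = {a\<in>A. f a > 0}"
  have hs: "(f has_sum d X) X" for X
    using has_sum_add[OF measure_spmf_has_sum[of \<nu>1 X]
        has_sum_cmult_right[OF measure_spmf_has_sum[of \<nu>2 X], of "- exp \<epsilon>"]]
    by (simp add: f_def d_def)
  have le: "d X \<le> d X0" if "X \<subseteq> A" for X
    using that by (intro has_sum_mono_neutral[OF hs hs]) (auto simp: X0_def)
  have "eps_dist A \<epsilon> \<nu>1 \<nu>2 = d X0"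
    unfolding eps_dist_def d_def[symmetric]
    by (rule cSup_eq_maximum) (use le in \<open>auto simp: X0_def\<close>)
  then show ?thesis
    using le by (intro exI[of _ X0]) (auto simp: X0_def d_def)
qed

text \<open>The fresh element \<open>\<star>\<close> is rendered as \<open>None\<close>, so \<open>A\<^sup>\<star>\<close> lives in the type \<open>'a option\<close>.\<close>

definition star_set :: "'a set \<Rightarrow> 'a option set" where
  "star_set A = Some ` A \<union> {None}"

definition star_rel :: "'a set \<Rightarrow> 'b set \<Rightarrow> ('a \<times> 'b) set \<Rightarrow> ('a option \<times> 'b option) set" where
  "star_rel A1 A2 R =
     map_prod Some Some ` R \<union> (Some ` A1) \<times> {None} \<union> {None} \<times> (Some ` A2)"

text \<open>
  \<open>map_spmf fst\<close> and \<open>map_spmf snd\<close> are the marginals, and \<open>map_spmf Some \<mu>\<close> is \<open>\<mu>\<close> extended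
  by \<open>\<mu>(\<star>) = 0\<close>.
\<close>

definition approx_lifting ::
  "'a set \<Rightarrow> 'b set \<Rightarrow> ('a \<times> 'b) set \<Rightarrow> real \<Rightarrow> real \<Rightarrow> 'a spmf \<Rightarrow> 'b spmf \<Rightarrow> bool" where
  "approx_lifting A1 A2 R \<epsilon> \<delta> \<mu>1 \<mu>2 \<longleftrightarrow>
     (\<exists>\<mu>L \<mu>R :: ('a option \<times> 'b option) spmf.
        set_spmf \<mu>L \<subseteq> star_set A1 \<times> star_set A2 \<and>
        set_spmf \<mu>R \<subseteq> star_set A1 \<times> star_set A2 \<and>
        map_spmf fst \<mu>L = map_spmf Some \<mu>1 \<and>
        map_spmf snd \<mu>R = map_spmf Some \<mu>2 \<and>
        set_spmf \<mu>L \<union> set_spmf \<mu>R \<subseteq> star_rel A1 A2 R \<and>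
        eps_dist (star_set A1 \<times> star_set A2) \<epsilon> \<mu>L \<mu>R \<le> \<delta>)"

end

theory Submission
  imports Defs
begin

text \<open>
  The hypothesis is the cut condition of a bipartite network with sources \<open>A1\<close> of capacity
  \<open>\<mu>1\<close>, sinks \<open>A2\<close> of capacity \<open>exp \<epsilon> * \<mu>2\<close> and uncapacitated edges \<open>R\<close>, so there is a flow
  \<open>f\<close> with at most \<open>\<delta>\<close> of \<open>\<mu>1\<close> left over. The lifting puts \<open>\<mu>L = f\<close> and \<open>\<mu>R = exp (- \<epsilon>) * f\<close>
  on \<open>R\<close> and sends the left-over masses to pairs with \<open>\<star>\<close>. A maximal flow exists in the infinite
  network because the flows are compact in the product topology and the total mass is
  continuous on them.
\<close>

section \<open>Flows with row and column capacities\<close>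

definition outflow :: "('a \<times> 'b \<Rightarrow> real) \<Rightarrow> 'a \<Rightarrow> real" where
  "outflow f a = (\<Sum>\<^sub>\<infinity>b. f (a, b))"

definition inflow :: "('a \<times> 'b \<Rightarrow> real) \<Rightarrow> 'b \<Rightarrow> real" where
  "inflow f b = (\<Sum>\<^sub>\<infinity>a. f (a, b))"

text \<open>The capacities bound finite partial sums instead of \<open>outflow\<close> and
  \<open>inflow\<close>. Each condition then involves only finitely many coordinates, hence is
  closed in the product topology, and it also forces summability, whereas \<open>infsum\<close>
  defaults to 0 on a divergent row.\<close>

definition flows :: "('a \<Rightarrow> real) \<Rightarrow> ('b \<Rightarrow> real) \<Rightarrow> ('a \<times> 'b) set \<Rightarrow> ('a \<times> 'b \<Rightarrow> real) set" where
  "flows u v R = {f. (\<forall>p. 0 \<le> f p) \<and> (\<forall>p. p \<in> R \<or> f p = 0) \<and>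
     (\<forall>a F. finite F \<longrightarrow> (\<Sum>b\<in>F. f (a, b)) \<le> u a) \<and>
     (\<forall>b F. finite F \<longrightarrow> (\<Sum>a\<in>F. f (a, b)) \<le> v b)}"

text \<open>Transposition exchanges sources and sinks, so every fact about columns is inherited from
  the one about rows.\<close>

lemma flows_swap:
  assumes "f \<in> flows u v R"
  shows "f \<circ> prod.swap \<in> flows v u (R\<inverse>)"
  using assms by (auto simp: flows_def)

lemma flows_nonneg: "f \<in> flows u v R \<Longrightarrow> 0 \<le> f p"
  unfolding flows_def by blast

lemma flows_outside: "f \<in> flows u v R \<Longrightarrow> p \<notin> R \<Longrightarrow> f p = 0"
  unfolding flows_def by blast

lemma flowsI:
  assumes nonneg: "\<And>p. 0 \<le> f p" and R: "\<And>p. p \<notin> R \<Longrightarrow> f p = 0"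
    and out: "\<And>a. ((\<lambda>b. f (a, b)) has_sum s a) UNIV" "\<And>a. s a \<le> u a"
    and inn: "\<And>b. ((\<lambda>a. f (a, b)) has_sum t b) UNIV" "\<And>b. t b \<le> v b"
  shows "f \<in> flows u v R"
proof -
  have "sum (\<lambda>b. f (a, b)) F \<le> u a" if "finite F" for a F
    using has_sum_mono_neutral[OF has_sum_finite[OF that] out(1)[of a]] out(2)[of a] nonneg
    by fastforce
  moreover have "sum (\<lambda>a. f (a, b)) F \<le> v b" if "finite F" for b F
    using has_sum_mono_neutral[OF has_sum_finite[OF that] inn(1)[of b]] inn(2)[of b] nonneg
    by fastforce
  ultimately show ?thesis
    unfolding flows_def using nonneg R by blast
qed

lemma outflow_has_sum:
  assumes "f \<in> flows u v R"
  shows "((\<lambda>b. f (a, b)) has_sum outflow f a) UNIV"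
  unfolding outflow_def
proof (intro has_sum_infsum nonneg_bdd_above_summable_on)
  show "bdd_above (sum (\<lambda>b. f (a, b)) ` {F. F \<subseteq> UNIV \<and> finite F})"
    using assms by (intro bdd_aboveI[of _ "u a"]) (auto simp: flows_def)
qed (use assms in \<open>auto simp: flows_def\<close>)

lemma outflow_le:
  assumes "f \<in> flows u v R"
  shows "outflow f a \<le> u a"
  unfolding outflow_def using outflow_has_sum[OF assms, of a] assms
  by (intro infsum_le_finite_sums) (auto simp: flows_def summable_on_def)

lemma outflow_nonneg: "f \<in> flows u v R \<Longrightarrow> 0 \<le> outflow f a"
  unfolding outflow_def by (intro infsum_nonneg flows_nonneg)

lemma inflow_conv_outflow: "inflow f = outflow (f \<circ> prod.swap)"
  by (simp add: fun_eq_iff inflow_def outflow_def)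

lemma inflow_has_sum: "f \<in> flows u v R \<Longrightarrow> ((\<lambda>a. f (a, b)) has_sum inflow f b) UNIV"
  using outflow_has_sum[OF flows_swap, of f u v R b] by (simp add: inflow_conv_outflow)

lemma inflow_le: "f \<in> flows u v R \<Longrightarrow> inflow f b \<le> v b"
  using outflow_le[OF flows_swap, of f u v R b] by (simp add: inflow_conv_outflow)

lemma flows_convex:
  assumes f: "f \<in> flows u v R" and g: "g \<in> flows u v R"
  shows "(\<lambda>p. (f p + g p) / 2) \<in> flows u v R"
proof (rule flowsI)
  show "((\<lambda>b. (f (a, b) + g (a, b)) / 2) has_sum (outflow f a + outflow g a) / 2) UNIV" for a
    by (intro has_sum_divide_const has_sum_add outflow_has_sum[OF f] outflow_has_sum[OF g])
  show "((\<lambda>a. (f (a, b) + g (a, b)) / 2) has_sum (inflow f b + inflow g b) / 2) UNIV" for b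
    by (intro has_sum_divide_const has_sum_add inflow_has_sum[OF f] inflow_has_sum[OF g])
  show "(outflow f a + outflow g a) / 2 \<le> u a" for a
    using outflow_le[OF f, of a] outflow_le[OF g, of a] by simp
  show "(inflow f a + inflow g a) / 2 \<le> v a" for a
    using inflow_le[OF f, of a] inflow_le[OF g, of a] by simp
qed (use f g in \<open>auto simp: flows_nonneg flows_outside\<close>)

lemma has_sum_diff:
  fixes f g :: "'c \<Rightarrow> real"
  assumes "(f has_sum s) A" "(g has_sum t) A"
  shows "((\<lambda>x. f x - g x) has_sum s - t) A"
  using has_sum_add[OF assms(1), of "\<lambda>x. - g x" "- t"] assms(2) by (simp add: has_sum_uminus)

lemma has_sum_single: "((\<lambda>x. if x = q then t else 0) has_sum (t::real)) UNIV"
  by (rule has_sum_finite_neutralI[of "{q}"]) auto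

lemma summable_tail:
  fixes w :: "'c \<Rightarrow> real"
  assumes "w summable_on UNIV" "e > 0"
  obtains F where "finite F" "infsum w (- F) < e"
proof -
  obtain F where F: "finite F" "dist (sum w F) (infsum w UNIV) \<le> e / 2"
    using infsum_finite_approximation[OF assms(1), of "e / 2"] assms(2) by auto
  have "infsum w UNIV = infsum w F + infsum w (- F)"
    using F(1) by (subst infsum_Un_disjoint[symmetric])
      (auto intro: summable_on_subset_banach[OF assms(1)])
  then have "infsum w (- F) < e"
    using F assms(2) by (simp add: dist_real_def)
  then show thesis using that F(1) by blast
qed

section \<open>Mass and tails of flows under summable capacities\<close>

locale network =
  fixes u :: "'a \<Rightarrow> real" and v :: "'b \<Rightarrow> real" and R :: "('a \<times> 'b) set"
  assumes u_nonneg: "\<And>a. 0 \<le> u a" and v_nonneg: "\<And>b. 0 \<le> v b"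
    and u_summable: "u summable_on UNIV" and v_summable: "v summable_on UNIV"
begin

lemma network_swap: "network v u"
  by unfold_locales (auto simp: u_nonneg v_nonneg u_summable v_summable)

lemma outflow_summable: "f \<in> flows u v R \<Longrightarrow> outflow f summable_on A"
  by (rule summable_on_comparison_test[OF summable_on_subset_banach[OF u_summable]])
    (auto simp: outflow_le outflow_nonneg)

lemma flow_summable:
  assumes "f \<in> flows u v R"
  shows "f summable_on P"
proof -
  have "f summable_on (SIGMA a:UNIV. UNIV)"
    by (rule summable_on_SigmaI[OF outflow_has_sum[OF assms] outflow_summable[OF assms]])
      (simp add: flows_nonneg[OF assms])
  then show ?thesis
    by (rule summable_on_subset_banach) auto
qed

lemma infsum_flow_rows:
  assumes "f \<in> flows u v R"
  shows "infsum f (A \<times> UNIV) = infsum (outflow f) A"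
  using infsum_Sigma_banach[where A = A and B = "\<lambda>_. UNIV", OF flow_summable[OF assms]]
  by (simp add: outflow_def[abs_def])

lemma infsum_flow_columns:
  assumes "f \<in> flows u v R"
  shows "infsum f (UNIV \<times> B) = infsum (inflow f) B"
proof -
  have "infsum f (UNIV \<times> B) = infsum (f \<circ> prod.swap) (B \<times> UNIV)"
    by (subst infsum_reindex[symmetric]) (auto simp: product_swap inj_on_def)
  then show ?thesis
    using network.infsum_flow_rows[OF network_swap flows_swap[OF assms]]
    by (simp add: inflow_conv_outflow)
qed

lemma inflow_summable: "f \<in> flows u v R \<Longrightarrow> inflow f summable_on B"
  unfolding inflow_conv_outflow
  by (rule network.outflow_summable[OF network_swap flows_swap])

lemma infsum_flow_mono:
  assumes "f \<in> flows u v R" "P \<subseteq> Q"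
  shows "infsum f P \<le> infsum f Q"
  using assms by (intro infsum_mono_neutral flow_summable) (auto simp: flows_nonneg)

text \<open>Mass outside \<open>A \<times> B\<close> lies in a row outside \<open>A\<close> or in a
  column outside \<open>B\<close>. The bound does not depend on \<open>f\<close>, which later makes
  the convergence of partial sums uniform.\<close>

lemma infsum_flow_tail:
  assumes f: "f \<in> flows u v R"
  shows "infsum f (- (A \<times> B)) \<le> infsum u (- A) + infsum v (- B)"
proof -
  have "infsum f (- (A \<times> B)) = infsum f ((- A) \<times> UNIV \<union> A \<times> (- B))"
    by (rule arg_cong[of _ _ "infsum f"]) auto
  also have "\<dots> = infsum f ((- A) \<times> UNIV) + infsum f (A \<times> (- B))"
    by (intro infsum_Un_disjoint flow_summable[OF f]) auto
  also have "infsum f ((- A) \<times> UNIV) \<le> infsum u (- A)"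
    unfolding infsum_flow_rows[OF f]
    by (intro infsum_mono outflow_summable[OF f] outflow_le[OF f]
        summable_on_subset_banach[OF u_summable]) auto
  also have "infsum f (A \<times> (- B)) \<le> infsum f (UNIV \<times> (- B))"
    by (intro infsum_flow_mono[OF f]) auto
  also have "\<dots> \<le> infsum v (- B)"
    unfolding infsum_flow_columns[OF f]
    by (intro infsum_mono inflow_summable[OF f] inflow_le[OF f]
        summable_on_subset_banach[OF v_summable]) auto
  finally show ?thesis by simp
qed

section \<open>Compactness of the set of flows and continuity of the total mass\<close>

text \<open>By Tychonoff the box of functions with values in \<open>{0..u (fst p)}\<close> is
  compact, and the flows form a closed subset of it. The entrywise bound is the row capacity for a
  singleton \<open>F\<close>.\<close>

lemma compact_flows: "compact (flows u v R)"
proof -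
  have cont: "continuous_on UNIV (\<lambda>f :: 'a \<times> 'b \<Rightarrow> real. f p)" for p
    by simp
  have "closed (flows u v R)"
    unfolding flows_def
    by (intro closed_Collect_conj closed_Collect_all closed_Collect_disj closed_Collect_imp
        closed_Collect_const closed_Collect_le closed_Collect_eq continuous_on_sum
        continuous_on_const cont) auto
  moreover have "compact (PiE UNIV (\<lambda>p :: 'a \<times> 'b. {0..u (fst p)}))"
    using compactin_PiE[of "\<lambda>_. euclidean" UNIV "\<lambda>p :: 'a \<times> 'b. {0..u (fst p)}"]
    by (simp add: euclidean_product_topology)
  moreover have "flows u v R \<subseteq> PiE UNIV (\<lambda>p. {0..u (fst p)})"
  proof
    fix f assume f: "f \<in> flows u v R"
    have "f (a, b) \<le> u a" for a b
      using f[unfolded flows_def] spec[of "\<lambda>F. finite F \<longrightarrow> (\<Sum>b\<in>F. f (a, b)) \<le> u a" "{b}"]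
      by simp
    then show "f \<in> PiE UNIV (\<lambda>p. {0..u (fst p)})"
      using f by (auto simp: flows_nonneg)
  qed
  ultimately show ?thesis
    by (metis compact_Int_closed inf.absorb_iff2)
qed

text \<open>
  The capacities bound the tails of all flows at once, so the total mass is a uniform limit of
  its finite partial sums.
\<close>

lemma continuous_on_total: "continuous_on (flows u v R) (\<lambda>f. infsum f UNIV)"
proof (rule uniform_limit_theorem)
  show "\<forall>\<^sub>F P in finite_subsets_at_top UNIV. continuous_on (flows u v R) (\<lambda>f. sum f P)"
    by (intro always_eventually allI continuous_on_sum)
      (metis continuous_on_product_coordinates continuous_on_subset top_greatest)
  show "uniform_limit (flows u v R) (\<lambda>P f. sum f P) (\<lambda>f. infsum f UNIV)
      (finite_subsets_at_top UNIV)"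
  proof (rule uniform_limitI)
    fix e :: real assume "e > 0"
    obtain A where A: "finite A" "infsum u (- A) < e / 2"
      using summable_tail[OF u_summable, of "e / 2"] \<open>e > 0\<close> by auto
    obtain B where B: "finite B" "infsum v (- B) < e / 2"
      using summable_tail[OF v_summable, of "e / 2"] \<open>e > 0\<close> by auto
    show "\<forall>\<^sub>F P in finite_subsets_at_top UNIV.
        \<forall>f\<in>flows u v R. dist (sum f P) (infsum f UNIV) < e"
      unfolding eventually_finite_subsets_at_top
    proof (intro exI[of _ "A \<times> B"] conjI allI impI ballI)
      fix P f assume P: "finite P \<and> A \<times> B \<subseteq> P \<and> P \<subseteq> UNIV" and f: "f \<in> flows u v R"
      have "infsum f UNIV = infsum f P + infsum f (- P)"
        by (subst infsum_Un_disjoint[symmetric]) (auto intro: flow_summable[OF f])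
      moreover have "infsum f (- P) \<le> infsum f (- (A \<times> B))"
        using P by (intro infsum_flow_mono[OF f]) auto
      moreover have "0 \<le> infsum f (- P)"
        by (intro infsum_nonneg flows_nonneg[OF f])
      ultimately show "dist (sum f P) (infsum f UNIV) < e"
        using P A B infsum_flow_tail[OF f, of A B] by (simp add: dist_real_def)
    qed (use A B in auto)
  qed
qed auto

section \<open>Maximal flows and minimal cuts\<close>

definition max_flow :: "('a \<times> 'b \<Rightarrow> real) \<Rightarrow> bool" where
  "max_flow f \<longleftrightarrow> f \<in> flows u v R \<and> (\<forall>g\<in>flows u v R. infsum g UNIV \<le> infsum f UNIV)"

lemma max_flow_exists: "\<exists>f. max_flow f"
proof -
  have "(\<lambda>_. 0) \<in> flows u v R"
    by (auto simp: flows_def u_nonneg v_nonneg)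
  then show ?thesis
    using continuous_attains_sup[OF compact_flows _ continuous_on_total]
    by (auto simp: max_flow_def)
qed

text \<open>Two maximal flows have the same total mass, so their average has it too.\<close>

lemma max_flow_convex:
  assumes f: "max_flow f" and g: "max_flow g"
  shows "max_flow (\<lambda>p. (f p + g p) / 2)"
proof -
  have flows: "f \<in> flows u v R" "g \<in> flows u v R"
    using f g by (auto simp: max_flow_def)
  have "((\<lambda>p. (f p + g p) / 2) has_sum (infsum f UNIV + infsum g UNIV) / 2) UNIV"
    by (intro has_sum_divide_const has_sum_add has_sum_infsum flow_summable flows)
  moreover have "infsum f UNIV = infsum g UNIV"
    using f g by (auto simp: max_flow_def intro: order_antisym)
  ultimately show ?thesis
    using f flows_convex[OF flows] by (auto simp: max_flow_def dest!: infsumI)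
qed

lemma outflow_convex:
  assumes "f \<in> flows u v R" "g \<in> flows u v R"
  shows "outflow (\<lambda>p. (f p + g p) / 2) a = (outflow f a + outflow g a) / 2"
  unfolding outflow_def[of "\<lambda>p. (f p + g p) / 2"]
  by (intro infsumI has_sum_divide_const has_sum_add outflow_has_sum[OF assms(1)]
      outflow_has_sum[OF assms(2)])

lemma inflow_convex:
  assumes "f \<in> flows u v R" "g \<in> flows u v R"
  shows "inflow (\<lambda>p. (f p + g p) / 2) b = (inflow f b + inflow g b) / 2"
  unfolding inflow_def[of "\<lambda>p. (f p + g p) / 2"]
  by (intro infsumI has_sum_divide_const has_sum_add inflow_has_sum[OF assms(1)]
      inflow_has_sum[OF assms(2)])

text \<open>With slack at both ends of an edge, raising \<open>f\<close> on it by the smaller slack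
  would give a flow of larger total mass.\<close>

lemma max_flow_saturates:
  assumes f: "max_flow f" and "(a, b) \<in> R" and out: "outflow f a < u a"
  shows "inflow f b = v b"
proof (rule ccontr)
  assume "inflow f b \<noteq> v b"
  have fl: "f \<in> flows u v R"
    using f by (simp add: max_flow_def)
  have lt: "inflow f b < v b"
    using inflow_le[OF fl, of b] \<open>inflow f b \<noteq> v b\<close> by simp
  define t where "t = min (u a - outflow f a) (v b - inflow f b)"
  have t: "t > 0" "t \<le> u a - outflow f a" "t \<le> v b - inflow f b"
    using lt out by (auto simp: t_def)
  define g where "g = (\<lambda>p. f p + (if p = (a, b) then t else 0))"
  have "g \<in> flows u v R"
  proof (rule flowsI)
    show "((\<lambda>y. g (x, y)) has_sum outflow f x + (if x = a then t else 0)) UNIV" for x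
      using has_sum_add[OF outflow_has_sum[OF fl, of x]
          has_sum_single[of b "if x = a then t else 0"]]
      by (rule has_sum_cong[THEN iffD1, rotated]) (simp add: g_def)
    show "((\<lambda>x. g (x, y)) has_sum inflow f y + (if y = b then t else 0)) UNIV" for y
      using has_sum_add[OF inflow_has_sum[OF fl, of y]
          has_sum_single[of a "if y = b then t else 0"]]
      by (rule has_sum_cong[THEN iffD1, rotated]) (simp add: g_def)
  qed (use t \<open>(a, b) \<in> R\<close> in \<open>auto simp: g_def flows_nonneg[OF fl] flows_outside[OF fl]
      outflow_le[OF fl] inflow_le[OF fl]\<close>)
  moreover have "infsum g UNIV = infsum f UNIV + t"
    unfolding g_def
    by (intro infsumI has_sum_add has_sum_infsum flow_summable[OF fl] has_sum_single)
  ultimately show False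
    using f t by (force simp: max_flow_def)
qed

text \<open>Rerouting mass from \<open>(a', b)\<close> to \<open>(a, b)\<close> frees capacity at \<open>a'\<close>.\<close>

lemma max_flow_reroute:
  assumes f: "max_flow f" and "(a, b) \<in> R" and out: "outflow f a < u a"
    and pos: "f (a', b) > 0"
  shows "\<exists>g. max_flow g \<and> outflow g a' < u a'"
proof (cases "a' = a")
  case False
  have fl: "f \<in> flows u v R"
    using f by (simp add: max_flow_def)
  \<comment> \<open>The amount moved is limited by the slack at \<open>a\<close> and by the mass
    available on \<open>(a', b)\<close>. Column \<open>b\<close> and the total mass do not change,
    so the new flow is still maximal.\<close>
  define t where "t = min (u a - outflow f a) (f (a', b))"
  have t: "t > 0" "t \<le> u a - outflow f a" "t \<le> f (a', b)"
    using pos out by (auto simp: t_def)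
  define g where
    "g = (\<lambda>p. f p + (if p = (a, b) then t else 0) + (if p = (a', b) then - t else 0))"
  have out_g: "((\<lambda>y. g (x, y)) has_sum
      outflow f x + (if x = a then t else 0) + (if x = a' then - t else 0)) UNIV" for x
    using has_sum_add[OF has_sum_add[OF outflow_has_sum[OF fl, of x]
        has_sum_single[of b "if x = a then t else 0"]]
        has_sum_single[of b "if x = a' then - t else 0"]]
    by (rule has_sum_cong[THEN iffD1, rotated]) (simp add: g_def)
  have "g \<in> flows u v R"
  proof (rule flowsI)
    show "((\<lambda>x. g (x, y)) has_sum
        inflow f y + (if y = b then t else 0) + (if y = b then - t else 0)) UNIV" for y
      using has_sum_add[OF has_sum_add[OF inflow_has_sum[OF fl, of y]
          has_sum_single[of a "if y = b then t else 0"]]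
          has_sum_single[of a' "if y = b then - t else 0"]]
      by (rule has_sum_cong[THEN iffD1, rotated]) (simp add: g_def)
    show "outflow f x + (if x = a then t else 0) + (if x = a' then - t else 0) \<le> u x" for x
      using t outflow_le[OF fl, of x] False by auto
    show "g p = 0" if "p \<notin> R" for p
      using that t flows_outside[OF fl, of p] \<open>(a, b) \<in> R\<close> by (auto simp: g_def)
    show "0 \<le> g p" for p
      using t False flows_nonneg[OF fl, of p] by (auto simp: g_def)
    show "inflow f y + (if y = b then t else 0) + (if y = b then - t else 0) \<le> v y" for y
      using inflow_le[OF fl, of y] by (cases "y = b") auto
  qed (rule out_g)
  moreover have "infsum g UNIV = infsum f UNIV + t + - t"
    unfolding g_def
    by (intro infsumI has_sum_add has_sum_infsum flow_summable[OF fl] has_sum_single)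
  moreover have "outflow g a' < u a'"
    unfolding outflow_def[of g] infsumI[OF out_g] using t False outflow_le[OF fl, of a'] by simp
  ultimately show ?thesis
    using f by (auto simp: max_flow_def)
qed (use f out in auto)

text \<open>
  The cut consists of the sources left unsaturated by some maximal flow. As maximal flows are
  closed under averaging, an arbitrary maximal flow can be compared with the witness of each
  such source, which replaces the usual augmenting paths.
\<close>

theorem max_flow_min_cut:
  "\<exists>f\<in>flows u v R. \<exists>S. infsum u (- S) + infsum v (R `` S) \<le> infsum f UNIV"
proof -
  obtain f where f: "max_flow f"
    using max_flow_exists by blast
  then have fl: "f \<in> flows u v R"
    by (simp add: max_flow_def)
  define S where "S = {a. \<exists>g. max_flow g \<and> outflow g a < u a}"
  have saturated: "inflow f b = v b"
    and closed: "f (a', b) > 0 \<Longrightarrow> a' \<in> S" if b: "b \<in> R `` S" for a' b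
  proof -
    obtain a g where ab: "(a, b) \<in> R" and g: "max_flow g" "outflow g a < u a"
      using b by (auto simp: S_def)
    then have gl: "g \<in> flows u v R"
      by (simp add: max_flow_def)
    \<comment> \<open>The average inherits the slack of \<open>g\<close> at \<open>a\<close>, since
      \<open>f\<close> stays within the capacity there. Conversely, if it saturates
      \<open>b\<close>, both flows do, and it is positive wherever \<open>f\<close> is. So what
      holds for \<open>?h\<close> on the column \<open>b\<close> carries over to
      \<open>f\<close>.\<close>
    let ?h = "\<lambda>p. (f p + g p) / 2"
    have h: "max_flow ?h" "outflow ?h a < u a"
      using max_flow_convex[OF f g(1)] outflow_convex[OF fl gl, of a] g(2) outflow_le[OF fl, of a]
      by auto
    show "inflow f b = v b"
      using max_flow_saturates[OF h(1) ab h(2)] inflow_convex[OF fl gl, of b]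
        inflow_le[OF fl, of b] inflow_le[OF gl, of b] by simp
    show "a' \<in> S" if "f (a', b) > 0"
      using max_flow_reroute[OF h(1) ab h(2), of a'] that flows_nonneg[OF gl, of "(a', b)"]
      by (auto simp: S_def)
  qed
  have zero: "f (a, b) = 0" if "a \<notin> S" "b \<in> R `` S" for a b
    using closed[OF that(2), of a] that(1) flows_nonneg[OF fl, of "(a, b)"] by force
  \<comment> \<open>A source outside \<open>S\<close> is saturated by every maximal flow, in
    particular by \<open>f\<close>.\<close>
  have "infsum u (- S) = infsum (outflow f) (- S)"
    using f outflow_le[OF fl] by (intro infsum_cong order_antisym) (auto simp: S_def not_less)
  also have "\<dots> = infsum f ((- S) \<times> UNIV)"
    by (simp add: infsum_flow_rows[OF fl])
  finally have u: "infsum u (- S) = infsum f ((- S) \<times> UNIV)" .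
  have "infsum v (R `` S) = infsum f (UNIV \<times> R `` S)"
    unfolding infsum_flow_columns[OF fl] by (rule infsum_cong) (simp add: saturated)
  also have "\<dots> = infsum f (S \<times> R `` S)"
    by (rule infsum_cong_neutral) (auto intro: zero)
  finally have "infsum u (- S) + infsum v (R `` S) = infsum f ((- S) \<times> UNIV \<union> S \<times> R `` S)"
    unfolding u by (subst infsum_Un_disjoint) (auto intro: flow_summable[OF fl])
  then show ?thesis
    using infsum_flow_mono[OF fl, of "(- S) \<times> UNIV \<union> S \<times> R `` S" UNIV]
    by (intro bexI[OF _ fl] exI[of _ S]) simp
qed

end

section \<open>Sub-distributions with prescribed weights\<close>

lemma spmf_of_weights:
  fixes w :: "'a \<Rightarrow> real"
  assumes nonneg: "\<And>x. 0 \<le> w x" and sum: "(w has_sum s) UNIV" and "s \<le> 1"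
  obtains \<mu> where "\<And>x. spmf \<mu> x = w x"
proof -
  have abs: "Infinite_Set_Sum.abs_summable_on w UNIV"
    using sum nonneg unfolding abs_summable_equivalent[symmetric] summable_on_def
    by auto
  have "(\<integral>\<^sup>+ x. ennreal (w x) \<partial>count_space UNIV) = ennreal s"
    using nn_integral_conv_infsetsum[OF abs] nonneg infsetsum_infsum[OF abs] infsumI[OF sum]
    by simp
  then have "spmf (embed_spmf w) x = w x" for x
    using \<open>s \<le> 1\<close> nonneg by (subst spmf_embed_spmf) simp_all
  then show thesis by (rule that)
qed

text \<open>The mass of \<open>\<mu> a\<close> not used by the row \<open>a\<close> of \<open>f\<close> is sent to the pair \<open>(a, \<star>)\<close>.\<close>

lemma spmf_extend_star:
  fixes \<mu> :: "'a spmf" and f :: "'a \<times> 'b \<Rightarrow> real"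
  assumes nonneg: "\<And>p. 0 \<le> f p"
    and row: "\<And>a. ((\<lambda>b. f (a, b)) has_sum r a) UNIV" and le: "\<And>a. r a \<le> spmf \<mu> a"
  obtains \<nu> where "\<And>a b. spmf \<nu> (Some a, Some b) = f (a, b)"
    and "\<And>a. spmf \<nu> (Some a, None) = spmf \<mu> a - r a" and "\<And>y. spmf \<nu> (None, y) = 0"
    and "map_spmf fst \<nu> = map_spmf Some \<mu>"
proof -
  define w :: "'a option \<times> 'b option \<Rightarrow> real" where
    "w = (\<lambda>(x, y). case x of None \<Rightarrow> 0
       | Some a \<Rightarrow> (case y of None \<Rightarrow> spmf \<mu> a - r a | Some b \<Rightarrow> f (a, b)))"
  \<comment> \<open>The intended first marginal: each row of \<open>w\<close> sums to
    \<open>m x\<close>, the row of \<open>None\<close> being empty. Summing over the rows,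
    \<open>w\<close> has the weight of \<open>\<mu>\<close>, hence at most 1.\<close>
  define m where "m = (\<lambda>x. case x of None \<Rightarrow> 0 | Some a \<Rightarrow> spmf \<mu> a)"
  have w_nonneg: "0 \<le> w p" for p
    using nonneg le by (auto simp: w_def split: prod.split option.split)
  have row_w: "((\<lambda>y. w (x, y)) has_sum m x) UNIV" for x
  proof (cases x)
    case None
    then show ?thesis by (simp add: w_def m_def)
  next
    case (Some a)
    have "((\<lambda>y. w (x, y)) has_sum r a) (range Some)"
      using row[of a] Some by (subst has_sum_reindex) (auto simp: w_def o_def)
    moreover have "((\<lambda>y. w (x, y)) has_sum spmf \<mu> a - r a) {None}"
      using Some by (intro has_sum_finiteI) (auto simp: w_def)
    ultimately have "((\<lambda>y. w (x, y)) has_sum r a + (spmf \<mu> a - r a)) (range Some \<union> {None})"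
      by (intro has_sum_Un_disjoint) auto
    then show ?thesis
      using Some by (simp add: m_def UNIV_option_conv Un_commute)
  qed
  have m_spmf: "m = spmf (map_spmf Some \<mu>)"
    by (auto simp: fun_eq_iff m_def spmf_map_inj' spmf_map_outside split: option.split)
  then have m_sum: "(m has_sum weight_spmf (map_spmf Some \<mu>)) UNIV"
    using measure_spmf_has_sum[of "map_spmf Some \<mu>" UNIV] by (simp add: weight_spmf_def)
  have "w summable_on (SIGMA x:UNIV. UNIV)"
    by (rule summable_on_SigmaI[OF row_w]) (use m_sum w_nonneg in \<open>auto simp: summable_on_def\<close>)
  then have "(w has_sum infsum w UNIV) (SIGMA x:UNIV. UNIV)"
    by simp
  moreover from has_sum_SigmaD[OF this row_w]
  have "infsum w UNIV = weight_spmf (map_spmf Some \<mu>)"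
    using m_sum by (rule has_sum_unique)
  ultimately obtain \<nu> where \<nu>: "\<And>p. spmf \<nu> p = w p"
    using spmf_of_weights[of w "infsum w UNIV"] w_nonneg by (auto simp: weight_spmf_le_1)
  have "map_spmf fst \<nu> = map_spmf Some \<mu>"
  proof (rule spmf_eqI)
    fix x
    show "spmf (map_spmf fst \<nu>) x = spmf (map_spmf Some \<mu>) x"
      using spmf_map_fst_has_sum[of \<nu> UNIV UNIV x, unfolded \<nu>, simplified]
        row_w[of x, unfolded m_spmf]
      by (rule has_sum_unique)
  qed
  then show thesis
    by (intro that[of \<nu>]) (auto simp: \<nu> w_def)
qed

section \<open>Construction of the lifting from a flow\<close>

theorem theorem5p8:
  fixes A1 :: "'a set" and A2 :: "'b set"
    and \<mu>1 :: "'a spmf" and \<mu>2 :: "'b spmf"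
    and R :: "('a \<times> 'b) set" and \<epsilon> \<delta> :: real
  assumes "countable A1" and "countable A2"
    and "set_spmf \<mu>1 \<subseteq> A1" and "set_spmf \<mu>2 \<subseteq> A2"
    and "R \<subseteq> A1 \<times> A2"
    and "\<And>S1. S1 \<subseteq> A1 \<Longrightarrow>
           measure (measure_spmf \<mu>1) S1
             \<le> exp \<epsilon> * measure (measure_spmf \<mu>2) {a2 \<in> A2. \<exists>a1\<in>S1. (a1, a2) \<in> R} + \<delta>"
  shows "approx_lifting A1 A2 R \<epsilon> \<delta> \<mu>1 \<mu>2"
proof -
  define u where "u = spmf \<mu>1"
  define v where "v = (\<lambda>b. exp \<epsilon> * spmf \<mu>2 b)"
  have u_sum: "(u has_sum measure (measure_spmf \<mu>1) X) X" for X
    unfolding u_def by (rule measure_spmf_has_sum)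
  have v_sum: "(v has_sum exp \<epsilon> * measure (measure_spmf \<mu>2) X) X" for X
    unfolding v_def by (intro has_sum_cmult_right measure_spmf_has_sum)
  interpret network u v R
    by unfold_locales (use u_sum v_sum in \<open>auto simp: u_def v_def summable_on_def\<close>)
  obtain f S where f: "f \<in> flows u v R"
    and cut: "infsum u (- S) + infsum v (R `` S) \<le> infsum f UNIV"
    using max_flow_min_cut by blast
  have "infsum u S = infsum u (S \<inter> A1)"
    using assms(3) by (intro infsum_cong_neutral) (auto simp: u_def spmf_eq_0_set_spmf)
  also have "\<dots> \<le> infsum v (R `` S) + \<delta>"
  proof -
    have "{a2 \<in> A2. \<exists>a1\<in>S \<inter> A1. (a1, a2) \<in> R} = R `` S"
      using assms(5) by auto
    then show ?thesis
      using assms(6)[of "S \<inter> A1"] by (simp add: infsumI[OF u_sum] infsumI[OF v_sum])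
  qed
  finally have "infsum u S \<le> infsum v (R `` S) + \<delta>" .
  moreover have "infsum u UNIV = infsum u S + infsum u (- S)"
    using u_sum by (subst infsum_Un_disjoint[symmetric]) (auto simp: summable_on_def)
  ultimately have deficit: "infsum u UNIV - infsum f UNIV \<le> \<delta>"
    using cut by simp

  obtain \<mu>L where L: "\<And>a b. spmf \<mu>L (Some a, Some b) = f (a, b)"
    "\<And>a. spmf \<mu>L (Some a, None) = spmf \<mu>1 a - outflow f a" "\<And>y. spmf \<mu>L (None, y) = 0"
    "map_spmf fst \<mu>L = map_spmf Some \<mu>1"
    using spmf_extend_star[OF flows_nonneg[OF f] outflow_has_sum[OF f], of \<mu>1]
      outflow_le[OF f] by (metis u_def)
  \<comment> \<open>The factor \<open>exp (- \<epsilon>)\<close> turns the column capacity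
    \<open>v b\<close> back into \<open>spmf \<mu>2 b\<close>. The extension by
    \<open>\<star>\<close> is then applied to the transposed flow, and \<open>prod.swap\<close>
    restores the order of the components.\<close>
  have "((\<lambda>a. exp (- \<epsilon>) * f (a, b)) has_sum exp (- \<epsilon>) * inflow f b) UNIV" for b
    by (intro has_sum_cmult_right inflow_has_sum[OF f])
  moreover have "exp (- \<epsilon>) * inflow f b \<le> spmf \<mu>2 b" for b
    using inflow_le[OF f, of b] by (simp add: v_def exp_minus field_simps)
  ultimately obtain \<nu> where \<nu>: "\<And>b a. spmf \<nu> (Some b, Some a) = exp (- \<epsilon>) * f (a, b)"
    "\<And>b. spmf \<nu> (Some b, None) = spmf \<mu>2 b - exp (- \<epsilon>) * inflow f b"
    "\<And>x. spmf \<nu> (None, x) = 0" "map_spmf fst \<nu> = map_spmf Some \<mu>2"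
    using spmf_extend_star[of "\<lambda>(b, a). exp (- \<epsilon>) * f (a, b)"
        "\<lambda>b. exp (- \<epsilon>) * inflow f b" \<mu>2] flows_nonneg[OF f]
    by (auto simp: split_def)
  define \<mu>R where "\<mu>R = map_spmf prod.swap \<nu>"
  have spmf_R: "spmf \<mu>R (x, y) = spmf \<nu> (y, x)" for x y
    using spmf_map_inj'[of prod.swap \<nu> "(y, x)"] by (simp add: \<mu>R_def)
  have R_snd: "map_spmf snd \<mu>R = map_spmf Some \<mu>2"
    unfolding \<mu>R_def spmf.map_comp using \<nu>(4) by (simp add: o_def)

  have supp_L: "p \<in> star_rel A1 A2 R" if "p \<in> set_spmf \<mu>L" for p
  proof -
    \<comment> \<open>The marginal excludes \<open>\<star>\<close> as first component and places it
      in \<open>A1\<close>. If the second component is not \<open>\<star>\<close> either, the weight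
      is an entry of \<open>f\<close>, which vanishes off \<open>R\<close>.\<close>
    have "fst p \<in> Some ` set_spmf \<mu>1"
      using that L(4) by (metis imageI set_map_spmf)
    then show ?thesis
      using that L(1)[of "the (fst p)" "the (snd p)"] assms(3) flows_outside[OF f]
      by (cases p; cases "snd p") (force simp: star_rel_def in_set_spmf_iff_spmf)+
  qed
  have supp_R: "p \<in> star_rel A1 A2 R" if "p \<in> set_spmf \<mu>R" for p
  proof -
    have "snd p \<in> Some ` set_spmf \<mu>2"
      using that R_snd by (metis imageI set_map_spmf)
    then show ?thesis
      using that \<nu>(1)[of "the (snd p)" "the (fst p)"] assms(4) flows_outside[OF f]
      by (cases p; cases "fst p") (force simp: star_rel_def in_set_spmf_iff_spmf spmf_R)+
  qed
  have star: "star_rel A1 A2 R \<subseteq> star_set A1 \<times> star_set A2"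
    using assms(5) by (auto simp: star_rel_def star_set_def)

  have "eps_dist (star_set A1 \<times> star_set A2) \<epsilon> \<mu>L \<mu>R \<le> \<delta>"
    unfolding eps_dist_def
  proof (rule cSUP_least)
    fix X
    let ?d = "\<lambda>p. spmf \<mu>L p - exp \<epsilon> * spmf \<mu>R p"
    let ?E = "range (\<lambda>a. (Some a, None)) :: ('a option \<times> 'b option) set"
    have d: "(?d has_sum measure (measure_spmf \<mu>L) X - exp \<epsilon> * measure (measure_spmf \<mu>R) X) X"
      by (intro has_sum_diff has_sum_cmult_right measure_spmf_has_sum)
    have "((\<lambda>a. u a - outflow f a) has_sum infsum u UNIV - infsum (outflow f) UNIV) UNIV"
      by (intro has_sum_diff has_sum_infsum u_summable outflow_summable[OF f])
    then have E: "(spmf \<mu>L has_sum infsum u UNIV - infsum f UNIV) ?E"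
      using infsum_flow_rows[OF f, of UNIV]
      by (subst has_sum_reindex) (auto simp: o_def L(2) u_def inj_on_def)
    \<comment> \<open>On pairs without \<open>\<star>\<close> the factors
      \<open>exp \<epsilon>\<close> and \<open>exp (- \<epsilon>)\<close> cancel and the difference
      is 0. On pairs \<open>(\<star>, y)\<close> only \<open>\<mu>R\<close> can have mass. Hence
      positive contributions come from \<open>?E\<close> alone, whose \<open>\<mu>L\<close>-mass is
      the deficit of the flow.\<close>
    have "?d p \<le> 0" if "p \<notin> ?E" for p
    proof -
      obtain x y where p: "p = (x, y)" by (cases p)
      show ?thesis
        using that by (cases x; cases y) (use inflow_le[OF f] in \<open>auto simp: p spmf_R L \<nu> v_def exp_minus field_simps\<close>)
    qed
    then have "measure (measure_spmf \<mu>L) X - exp \<epsilon> * measure (measure_spmf \<mu>R) X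
        \<le> infsum u UNIV - infsum f UNIV"
      by (intro has_sum_mono_neutral[OF d E]) auto
    with deficit show "measure (measure_spmf \<mu>L) X - exp \<epsilon> * measure (measure_spmf \<mu>R) X \<le> \<delta>"
      by simp
  qed auto
  then show ?thesis
    unfolding approx_lifting_def using supp_L supp_R star L(4) R_snd
    by (intro exI[of _ \<mu>L] exI[of _ \<mu>R]) blast
qed

end
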